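(* Let $\Omega$ be an $I$-graded poset with an up rule $U$ and a down rule $D$, and let $(\pi_i\in M(\Omega_i))_{i\in I}$ be a sequence of probability distributions. The following are equivalent. (a) $(\pi_i)_{i\in I}$ is both a $U$-sequence and a $D$-sequence (and hence $U$ and $D$ are compatible). (b) For any $i$ with $i,i+1\in I$, the distribution $(\pi_i+\pi_{i+1})/2$ is a stationary distribution of the $UD$-process on $\Omega_i\cup\Omega_{i+1}$.
   Context: Let $I\subseteq\mathbb{Z}$ be a (possibly infinite) nonempty interval of integers. An $I$-graded poset $\Omega$ is a countable (or finite) poset with a surjective map $\rho\colon\Omega\to I$ (the rank function) such that $u<v$ implies $\rho(u)<\rho(v)$, and $u\lessdot v$ implies $\rho(v)=\rho(u)+1$. Here $u\lessdot v$ means that $v$ covers $u$. The level sets are $\Omega_i=\rho^{-1}(i)$. An up rule on $\Omega$ is an assignment of a probability $U(u\rightarrow v)\in[0,1]$ to each pair $(u,v)\in\Omega\times\Omega$ such that $U(u\rightarrow v)>0\Leftrightarrow u\lessdot v$, and $\sum_{v\in\Omega}U(u\rightarrow v)=1$ for every $u$ of non-maximal rank. A down rule is an assignment $D(u\rightarrow v)\in[0,1]$ such that $D(u\rightarrow v)>0\Leftrightarrow v\lessdot u$, and $\sum_{v\in\Omega}D(u\rightarrow v)=1$ for every $u$ of non-minimal rank. $\ell_1(\Omega)$ is the Banach space of functions $f\colon\Omega\to\mathbb{R}$ with $\sum_{u}|f(u)|<\infty$. $M(\Omega_i)$ is the set of $\pi\in\ell_1(\Omega)$ that vanish outside $\Omega_i$,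 are nonnegative, and satisfy $\sum_{u\in\Omega_i}\pi(u)=1$. An up or down rule $T$ induces a linear operator on $\ell_1(\Omega)$ by $(T\pi)(v)=\sum_{u\in\Omega}T(u\rightarrow v)\pi(u)$. The sequence $(\pi_i\in M(\Omega_i))_{i\in I}$ is a $U$-sequence if $U\pi_i=\pi_{i+1}$ for every non-maximal $i\in I$, and a $D$-sequence if $D\pi_i=\pi_{i-1}$ for every non-minimal $i\in I$. $U$ and $D$ are compatible if there are a Markov chain $(X_i\in\Omega_i)_{i\in I}$ with transitions $X_i\to X_{i+1}$ given by $U$ (that is, $\mathrm{Prob}(X_i=u, X_{i+1}=v)=\mathrm{Prob}(X_i=u)U(u\rightarrow v)$) and a Markov chain $(Y_i\in\Omega_i)_{i\in I}$ with transitions $Y_i\to Y_{i-1}$ given by $D$ (that is, $\mathrm{Prob}(Y_i=u, Y_{i-1}=v)=\mathrm{Prob}(Y_i=u)D(u\rightarrow v)$) such that $X_i$ and $Y_i$ are equally distributed for every $i\in I$. The $UD$-process on the adjacent levels $\Omega_i\cup\Omega_{i+1}$ is the Markov chain that toggles between the two levels: from a state $u\in\Omega_i$ it moves to $v\in\Omega_{i+1}$ with probability $U(u\rightarrow v)$, and from a state $v\in\Omega_{i+1}$ it moves to $u\in\Omega_i$ with probability $D(v\rightarrow u)$. A stationary distribution is a probability distribution on $\Omega_i\cup\Omega_{i+1}$ that is invariant under one step of this chain. *)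

theory Defs
  imports "HOL-Probability.Probability"
begin

definition int_interval :: "int set \<Rightarrow> bool" where
  "int_interval I \<longleftrightarrow> I \<noteq> {} \<and> (\<forall>a\<in>I. \<forall>b\<in>I. {a..b} \<subseteq> I)"

definition nonmaximal :: "int set \<Rightarrow> int \<Rightarrow> bool" where
  "nonmaximal I i \<longleftrightarrow> i \<in> I \<and> (\<exists>j\<in>I. i < j)"

definition nonminimal :: "int set \<Rightarrow> int \<Rightarrow> bool" where
  "nonminimal I i \<longleftrightarrow> i \<in> I \<and> (\<exists>j\<in>I. j < i)"

definition covered_by :: "'a::order \<Rightarrow> 'a \<Rightarrow> bool" (infix "\<lessdot>" 50) where
  "u \<lessdot> v \<longleftrightarrow> u < v \<and> \<not> (\<exists>w. u < w \<and> w < v)"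

text \<open>The poset is the whole type \<open>'a\<close>, with the order of its class instance.\<close>

definition graded_poset :: "int set \<Rightarrow> ('a::order \<Rightarrow> int) \<Rightarrow> bool" where
  "graded_poset I \<rho> \<longleftrightarrow>
     int_interval I \<and> countable (UNIV :: 'a set) \<and> range \<rho> = I \<and>
     (\<forall>u v. u < v \<longrightarrow> \<rho> u < \<rho> v) \<and>
     (\<forall>u v. u \<lessdot> v \<longrightarrow> \<rho> v = \<rho> u + 1)"

definition level :: "('a \<Rightarrow> int) \<Rightarrow> int \<Rightarrow> 'a set" where
  "level \<rho> i = \<rho> -` {i}"

definition up_rule :: "int set \<Rightarrow> ('a::order \<Rightarrow> int) \<Rightarrow> ('a \<Rightarrow> 'a \<Rightarrow> real) \<Rightarrow> bool" where
  "up_rule I \<rho> U \<longleftrightarrow>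
     (\<forall>u v. 0 \<le> U u v \<and> U u v \<le> 1) \<and>
     (\<forall>u v. U u v > 0 \<longleftrightarrow> u \<lessdot> v) \<and>
     (\<forall>u. nonmaximal I (\<rho> u) \<longrightarrow> (U u has_sum 1) UNIV)"

definition down_rule :: "int set \<Rightarrow> ('a::order \<Rightarrow> int) \<Rightarrow> ('a \<Rightarrow> 'a \<Rightarrow> real) \<Rightarrow> bool" where
  "down_rule I \<rho> D \<longleftrightarrow>
     (\<forall>u v. 0 \<le> D u v \<and> D u v \<le> 1) \<and>
     (\<forall>u v. D u v > 0 \<longleftrightarrow> v \<lessdot> u) \<and>
     (\<forall>u. nonminimal I (\<rho> u) \<longrightarrow> (D u has_sum 1) UNIV)"

definition l1 :: "('a \<Rightarrow> real) set" where
  "l1 = {f. (\<lambda>u. \<bar>f u\<bar>) summable_on UNIV}"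

definition prob_dists :: "'a set \<Rightarrow> ('a \<Rightarrow> real) set" where
  "prob_dists S = {\<pi> \<in> l1. (\<forall>u. u \<notin> S \<longrightarrow> \<pi> u = 0) \<and> (\<forall>u. 0 \<le> \<pi> u) \<and> (\<pi> has_sum 1) S}"

definition rule_op :: "('a \<Rightarrow> 'a \<Rightarrow> real) \<Rightarrow> ('a \<Rightarrow> real) \<Rightarrow> 'a \<Rightarrow> real" where
  "rule_op T \<pi> v = (\<Sum>\<^sub>\<infinity>u. T u v * \<pi> u)"

definition U_sequence :: "int set \<Rightarrow> ('a \<Rightarrow> 'a \<Rightarrow> real) \<Rightarrow> (int \<Rightarrow> 'a \<Rightarrow> real) \<Rightarrow> bool" where
  "U_sequence I U \<pi> \<longleftrightarrow> (\<forall>i. nonmaximal I i \<longrightarrow> rule_op U (\<pi> i) = \<pi> (i + 1))"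

definition D_sequence :: "int set \<Rightarrow> ('a \<Rightarrow> 'a \<Rightarrow> real) \<Rightarrow> (int \<Rightarrow> 'a \<Rightarrow> real) \<Rightarrow> bool" where
  "D_sequence I D \<pi> \<longleftrightarrow> (\<forall>i. nonminimal I i \<longrightarrow> rule_op D (\<pi> i) = \<pi> (i - 1))"

text \<open>
  In the chain definitions below, the case \<open>m = i\<close> of the last clause is the one-step
  transition law \<open>Prob(X\<^sub>i = u, X\<^sub>i\<^sub>+\<^sub>1 = v) = Prob(X\<^sub>i = u) U(u \<rightarrow> v)\<close>, and the general case
  adds the Markov property: given \<open>X\<^sub>m, \<dots>, X\<^sub>i\<close>, the law of the next state depends on \<open>X\<^sub>i\<close> only.
  It is stated without division, so no condition on null events is needed. Histories of
  finite length suffice also when \<open>I\<close> is unbounded. The down chain runs from larger to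
  smaller indices, so its history lies above \<open>i\<close>.
\<close>

definition up_chain ::
  "int set \<Rightarrow> ('a \<Rightarrow> int) \<Rightarrow> ('a \<Rightarrow> 'a \<Rightarrow> real) \<Rightarrow> 'w measure \<Rightarrow> (int \<Rightarrow> 'w \<Rightarrow> 'a) \<Rightarrow> bool" where
  "up_chain I \<rho> U M X \<longleftrightarrow>
     prob_space M \<and>
     (\<forall>i\<in>I. X i \<in> measurable M (count_space (level \<rho> i))) \<and>
     (\<forall>m\<in>I. \<forall>i. nonmaximal I i \<longrightarrow> m \<le> i \<longrightarrow> (\<forall>x.
        measure M {\<omega> \<in> space M. \<forall>j\<in>{m..i+1}. X j \<omega> = x j} =
        measure M {\<omega> \<in> space M. \<forall>j\<in>{m..i}. X j \<omega> = x j} * U (x i) (x (i + 1))))"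

definition down_chain ::
  "int set \<Rightarrow> ('a \<Rightarrow> int) \<Rightarrow> ('a \<Rightarrow> 'a \<Rightarrow> real) \<Rightarrow> 'w measure \<Rightarrow> (int \<Rightarrow> 'w \<Rightarrow> 'a) \<Rightarrow> bool" where
  "down_chain I \<rho> D M Y \<longleftrightarrow>
     prob_space M \<and>
     (\<forall>i\<in>I. Y i \<in> measurable M (count_space (level \<rho> i))) \<and>
     (\<forall>m\<in>I. \<forall>i. nonminimal I i \<longrightarrow> i \<le> m \<longrightarrow> (\<forall>y.
        measure M {\<omega> \<in> space M. \<forall>j\<in>{i-1..m}. Y j \<omega> = y j} =
        measure M {\<omega> \<in> space M. \<forall>j\<in>{i..m}. Y j \<omega> = y j} * D (y i) (y (i - 1))))"

text \<open>
  HOL cannot quantify existentially over the type of the sample space. Taking it to be the type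
  of paths \<open>int \<Rightarrow> 'a\<close> loses no generality: the conditions depend only on the joint law
  of the process, which can be realised on path space.
\<close>

definition compatible ::
  "int set \<Rightarrow> ('a \<Rightarrow> int) \<Rightarrow> ('a \<Rightarrow> 'a \<Rightarrow> real) \<Rightarrow> ('a \<Rightarrow> 'a \<Rightarrow> real) \<Rightarrow> bool" where
  "compatible I \<rho> U D \<longleftrightarrow>
     (\<exists>(M :: (int \<Rightarrow> 'a) measure) X (N :: (int \<Rightarrow> 'a) measure) Y.
        up_chain I \<rho> U M X \<and> down_chain I \<rho> D N Y \<and>
        (\<forall>i\<in>I. distr M (count_space (level \<rho> i)) (X i) = distr N (count_space (level \<rho> i)) (Y i)))"

definition UD_states :: "('a \<Rightarrow> int) \<Rightarrow> int \<Rightarrow> 'a set" where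
  "UD_states \<rho> i = level \<rho> i \<union> level \<rho> (i + 1)"

definition UD_kernel ::
  "('a \<Rightarrow> int) \<Rightarrow> ('a \<Rightarrow> 'a \<Rightarrow> real) \<Rightarrow> ('a \<Rightarrow> 'a \<Rightarrow> real) \<Rightarrow> int \<Rightarrow> 'a \<Rightarrow> 'a \<Rightarrow> real" where
  "UD_kernel \<rho> U D i u v =
     (if u \<in> level \<rho> i \<and> v \<in> level \<rho> (i + 1) then U u v
      else if u \<in> level \<rho> (i + 1) \<and> v \<in> level \<rho> i then D u v
      else 0)"

definition stationary :: "'a set \<Rightarrow> ('a \<Rightarrow> 'a \<Rightarrow> real) \<Rightarrow> ('a \<Rightarrow> real) \<Rightarrow> bool" where
  "stationary S K \<mu> \<longleftrightarrow>
     \<mu> \<in> prob_dists S \<and> (\<forall>v\<in>S. (\<Sum>\<^sub>\<infinity>u\<in>S. \<mu> u * K u v) = \<mu> v)"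

end

theory Submission
  imports Defs
begin

text \<open>
  The equivalence is a matter of reading the stationarity equation level by level. Mass at a
  vertex of the upper level can only arrive from the lower level through \<open>U\<close>, and mass at the
  lower level only from the upper level through \<open>D\<close>; since each level carries half of the total
  mass, \<open>(\<pi>\<^sub>i + \<pi>\<^sub>i\<^sub>+\<^sub>1) / 2\<close> is invariant exactly if \<open>U \<pi>\<^sub>i = \<pi>\<^sub>i\<^sub>+\<^sub>1\<close> and \<open>D \<pi>\<^sub>i\<^sub>+\<^sub>1 = \<pi>\<^sub>i\<close>
  (\<open>stationary_UD_iff\<close>).

  Compatibility asks for actual Markov chains. When \<open>I\<close> is unbounded below, the up chain has no
  initial time from which it could be run, so it is obtained from the Kolmogorov extension theorem.
  On a finite window \<open>{m..m'}\<close> one starts from \<open>\<pi>\<^sub>m\<close> and takes steps of \<open>U\<close>. Forgetting the last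
  times always gives the law of a shorter segment; forgetting the first times does so precisely
  because \<open>U \<pi>\<^sub>i = \<pi>\<^sub>i\<^sub>+\<^sub>1\<close>. These laws are therefore consistent (\<open>path_segment_window\<close>) and have
  a projective limit, which has one-dimensional marginals \<open>\<pi>\<^sub>i\<close> and inherits the Markov property
  from the segments (\<open>markov_path_measure_exists\<close>). The extension theorem concerns Polish state
  spaces, so the countable poset is coded into the reals and decoded again
  (\<open>markov_chain_exists\<close>). The down chain is an up chain for the reversed index set
  \<open>- I\<close>, and both chains have the law \<open>\<pi>\<^sub>i\<close> at time \<open>i\<close>.
\<close>

section \<open>Finite path segments\<close>

text \<open>
  The chain started at time \<open>m\<close> from \<open>p m\<close> and run for \<open>n\<close> steps of the kernel \<open>K\<close>. Paths are total
  functions on the integers; their values at times outside \<open>{m..m + n}\<close> are mere fillers, so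
  that segments are only ever compared after restriction to a set of times inside this window.
\<close>

primrec path_segment :: "(int \<Rightarrow> 's pmf) \<Rightarrow> ('s \<Rightarrow> 's pmf) \<Rightarrow> int \<Rightarrow> nat \<Rightarrow> (int \<Rightarrow> 's) pmf" where
  "path_segment p K m 0 = map_pmf (\<lambda>x _. x) (p m)"
| "path_segment p K m (Suc n) =
     bind_pmf (path_segment p K m n)
       (\<lambda>\<omega>. map_pmf (\<lambda>v. fun_upd \<omega> (m + int n + 1) v) (K (\<omega> (m + int n))))"

lemma path_segment_drop_last:
  assumes "J \<subseteq> {..m + int n}"
  shows "map_pmf (\<lambda>\<omega>. restrict \<omega> J) (path_segment p K m (n + k)) =
         map_pmf (\<lambda>\<omega>. restrict \<omega> J) (path_segment p K m n)"
proof (induction k)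
  case (Suc k)
  have "restrict (fun_upd \<omega> (m + int (n + k) + 1) v) J = restrict \<omega> J" for \<omega> :: "int \<Rightarrow> 'a" and v
    using assms by (auto simp: restrict_def fun_eq_iff)
  then have "map_pmf (\<lambda>\<omega>. restrict \<omega> J) (path_segment p K m (n + Suc k)) =
      bind_pmf (path_segment p K m (n + k)) (\<lambda>\<omega>. return_pmf (restrict \<omega> J))"
    by (simp add: map_bind_pmf map_pmf_comp)
  with Suc show ?case by (simp add: map_pmf_def del: restrict_apply)
qed simp

text \<open>
  The hypothesis says that the first step carries \<open>p m\<close> to \<open>p (m + 1)\<close>, so that a segment seen from
  time \<open>m + 1\<close> on starts as the shorter segment does. The induction propagates this because
  a step depends on the past only through a time inside the window.
\<close>

lemma path_segment_drop_first:
  assumes "bind_pmf (p m) K = p (m + 1)"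
  shows "map_pmf (\<lambda>\<omega>. restrict \<omega> {m + 1..m + 1 + int n}) (path_segment p K m (Suc n)) =
         map_pmf (\<lambda>\<omega>. restrict \<omega> {m + 1..m + 1 + int n}) (path_segment p K (m + 1) n)"
proof (induction n)
  case 0
  have "map_pmf (\<lambda>\<omega>. restrict \<omega> {m + 1}) (path_segment p K m (Suc 0)) =
      map_pmf (\<lambda>v. restrict (\<lambda>_. v) {m + 1}) (bind_pmf (p m) K)"
    by (auto simp: map_bind_pmf bind_map_pmf map_pmf_comp restrict_def fun_eq_iff
        intro!: bind_pmf_cong map_pmf_cong)
  then show ?case by (simp add: assms map_pmf_comp del: restrict_apply path_segment.simps(2))
next
  case (Suc n)
  let ?W = "{m + 1..m + 1 + int n}" and ?W' = "{m + 1..m + 1 + int (Suc n)}"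
  let ?step = "\<lambda>\<omega>. map_pmf (\<lambda>v. restrict (fun_upd \<omega> (m + int n + 2) v) ?W') (K (\<omega> (m + int n + 1)))"
  \<comment> \<open>The restriction to \<open>?W\<close> keeps the current state, at time \<open>m + n + 1\<close>, and all the past that survives.\<close>
  have local: "?step (restrict \<omega> ?W) = ?step \<omega>" for \<omega>
  proof -
    have "restrict (fun_upd (restrict \<omega> ?W) (m + int n + 2) v) ?W' = restrict (fun_upd \<omega> (m + int n + 2) v) ?W'" for v
      by (auto simp: restrict_def fun_eq_iff)
    then show ?thesis by simp
  qed
  have "map_pmf (\<lambda>\<omega>. restrict \<omega> ?W') (path_segment p K m (Suc (Suc n))) =
      bind_pmf (path_segment p K m (Suc n)) ?step"
    by (subst path_segment.simps) (simp add: map_bind_pmf map_pmf_comp algebra_simps)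
  also have "\<dots> = bind_pmf (map_pmf (\<lambda>\<omega>. restrict \<omega> ?W) (path_segment p K m (Suc n))) ?step"
    by (simp only: bind_map_pmf local)
  also have "\<dots> = bind_pmf (path_segment p K (m + 1) n) ?step"
    by (simp only: Suc bind_map_pmf local)
  also have "\<dots> = map_pmf (\<lambda>\<omega>. restrict \<omega> ?W') (path_segment p K (m + 1) (Suc n))"
    by (simp add: map_bind_pmf map_pmf_comp algebra_simps)
  finally show ?case .
qed

lemma map_restrict_subset:
  assumes "map_pmf (\<lambda>\<omega>. restrict \<omega> H) q = map_pmf (\<lambda>\<omega>. restrict \<omega> H) r" "J \<subseteq> H"
  shows "map_pmf (\<lambda>\<omega>. restrict \<omega> J) q = map_pmf (\<lambda>\<omega>. restrict \<omega> J) r"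
proof -
  have "map_pmf (\<lambda>\<omega>. restrict \<omega> J) (map_pmf (\<lambda>\<omega>. restrict \<omega> H) s) = map_pmf (\<lambda>\<omega>. restrict \<omega> J) s" for s
    using assms(2) by (simp add: map_pmf_comp Int_absorb1)
  then show ?thesis using assms(1) by metis
qed

lemma path_segment_drop_initial:
  assumes "\<And>j. m \<le> j \<Longrightarrow> j < m + int k \<Longrightarrow> bind_pmf (p j) K = p (j + 1)"
    and "J \<subseteq> {m + int k..m + int k + int n}"
  shows "map_pmf (\<lambda>\<omega>. restrict \<omega> J) (path_segment p K m (k + n)) =
         map_pmf (\<lambda>\<omega>. restrict \<omega> J) (path_segment p K (m + int k) n)"
  using assms
proof (induction k arbitrary: m)
  case (Suc k)
  have "map_pmf (\<lambda>\<omega>. restrict \<omega> J) (path_segment p K m (Suc (k + n))) =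
      map_pmf (\<lambda>\<omega>. restrict \<omega> J) (path_segment p K (m + 1) (k + n))"
    using Suc.prems
    by (intro map_restrict_subset[OF path_segment_drop_first]) (auto simp: subset_iff)
  also have "\<dots> = map_pmf (\<lambda>\<omega>. restrict \<omega> J) (path_segment p K (m + 1 + int k) n)"
    using Suc.prems by (intro Suc.IH) (auto simp: algebra_simps)
  finally show ?case by (simp add: add_ac del: restrict_apply path_segment.simps)
qed simp

text \<open>
  Consistency of the segment laws: a set of times \<open>J\<close> has the same joint law in every window that
  contains it.
\<close>

lemma path_segment_window:
  assumes "\<And>j. m \<le> j \<Longrightarrow> j < m' \<Longrightarrow> bind_pmf (p j) K = p (j + 1)"
    and "m \<le> a" "a \<le> b" "b \<le> m'" "J \<subseteq> {a..b}"
  shows "map_pmf (\<lambda>\<omega>. restrict \<omega> J) (path_segment p K m (nat (m' - m))) =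
         map_pmf (\<lambda>\<omega>. restrict \<omega> J) (path_segment p K a (nat (b - a)))"
proof -
  have "nat (m' - m) = nat (a - m) + (nat (b - a) + nat (m' - b))"
    using assms by linarith
  moreover have "map_pmf (\<lambda>\<omega>. restrict \<omega> J)
        (path_segment p K m (nat (a - m) + (nat (b - a) + nat (m' - b)))) =
      map_pmf (\<lambda>\<omega>. restrict \<omega> J)
        (path_segment p K (m + int (nat (a - m))) (nat (b - a) + nat (m' - b)))"
    using assms by (intro path_segment_drop_initial) (auto simp: subset_iff)
  moreover have "map_pmf (\<lambda>\<omega>. restrict \<omega> J) (path_segment p K a (nat (b - a) + nat (m' - b))) =
      map_pmf (\<lambda>\<omega>. restrict \<omega> J) (path_segment p K a (nat (b - a)))"
    using assms by (intro path_segment_drop_last) (auto simp: subset_iff)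
  ultimately show ?thesis using assms by simp
qed

lemma path_segment_markov:
  "measure (path_segment p K m (Suc n)) {\<omega>. \<forall>j\<in>{m..m + int n + 1}. \<omega> j = x j} =
   measure (path_segment p K m n) {\<omega>. \<forall>j\<in>{m..m + int n}. \<omega> j = x j} *
     pmf (K (x (m + int n))) (x (m + int n + 1))"
proof -
  let ?t = "m + int n"
  let ?A = "{\<omega>. \<forall>j\<in>{m..?t}. \<omega> j = x j}" and ?B = "{\<omega>. \<forall>j\<in>{m..?t + 1}. \<omega> j = x j}"
  have step: "emeasure (map_pmf (\<lambda>v. fun_upd \<omega> (?t + 1) v) (K (\<omega> ?t))) ?B =
      ennreal (pmf (K (x ?t)) (x (?t + 1))) * indicator ?A \<omega>" for \<omega>
  proof -
    have "(\<lambda>v. fun_upd \<omega> (?t + 1) v) -` ?B = (if \<omega> \<in> ?A then {x (?t + 1)} else {})"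
    proof (intro set_eqI)
      fix v
      have "(\<forall>j\<in>{m..?t + 1}. (fun_upd \<omega> (?t + 1) v) j = x j) \<longleftrightarrow>
          v = x (?t + 1) \<and> (\<forall>j\<in>{m..?t}. \<omega> j = x j)"
      proof -
        have "{m..?t + 1} = insert (?t + 1) {m..?t}" by auto
        then show ?thesis by simp
      qed
      then show "v \<in> (\<lambda>v. fun_upd \<omega> (?t + 1) v) -` ?B \<longleftrightarrow>
          v \<in> (if \<omega> \<in> ?A then {x (?t + 1)} else {})"
        by (simp del: fun_upd_apply)
    qed
    moreover have "\<omega> \<in> ?A \<Longrightarrow> \<omega> ?t = x ?t" by auto
    ultimately show ?thesis
      by (auto simp: emeasure_pmf_single indicator_def)
  qed
  have "emeasure (path_segment p K m (Suc n)) ?B =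
      ennreal (pmf (K (x ?t)) (x (?t + 1))) * emeasure (path_segment p K m n) ?A"
    by (simp only: path_segment.simps emeasure_bind_pmf step)
      (simp add: nn_integral_cmult del: emeasure_map_pmf)
  then show ?thesis
    by (simp add: measure_def enn2real_mult mult.commute)
qed

section \<open>Extension to infinite index intervals\<close>

text \<open>
  Equality of segment laws is available for mass functions after restriction; this turns it into
  equality of measures on the product space.
\<close>

lemma distr_map_restrict:
  assumes "space M = UNIV"
  shows "distr (measure_pmf q) (PiM J (\<lambda>_. M)) (\<lambda>\<omega>. restrict \<omega> J) =
   distr (measure_pmf (map_pmf (\<lambda>\<omega>. restrict \<omega> J) q)) (PiM J (\<lambda>_. M)) (\<lambda>\<omega>. restrict \<omega> J)"
  using assms
  by (auto simp: map_pmf_rep_eq distr_distr space_PiM comp_def Pi_iff)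

text \<open>
  Kolmogorov extension of the segment laws. The measure exists for any interval of times, bounded or
  not, because its finite-dimensional laws are prescribed by windows and not by an initial
  distribution.
\<close>

lemma markov_path_measure_exists:
  fixes p :: "int \<Rightarrow> 's::polish_space pmf"
  assumes I: "int_interval I"
    and step: "\<And>i. i \<in> I \<Longrightarrow> i + 1 \<in> I \<Longrightarrow> bind_pmf (p i) K = p (i + 1)"
  shows "\<exists>M. prob_space M \<and> sets M = sets (PiM I (\<lambda>_. borel)) \<and>
    (\<forall>i\<in>I. \<forall>A\<in>sets borel. measure M {\<omega>\<in>space M. \<omega> i \<in> A} = measure (p i) A) \<and>
    (\<forall>m\<in>I. \<forall>i\<in>I. i + 1 \<in> I \<longrightarrow> m \<le> i \<longrightarrow> (\<forall>x.
      measure M {\<omega>\<in>space M. \<forall>j\<in>{m..i+1}. \<omega> j = x j} =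
      measure M {\<omega>\<in>space M. \<forall>j\<in>{m..i}. \<omega> j = x j} * pmf (K (x i)) (x (i + 1))))"
proof -
  have interval: "{a..b} \<subseteq> I" if "a \<in> I" "b \<in> I" for a b
    using I that by (auto simp: int_interval_def)
  \<comment> \<open>The law on \<open>J\<close> is read off from the smallest window around \<open>J\<close>. For \<open>J = {}\<close> the window is meaningless,
    but there is only one path over no times at all.\<close>
  define P where "P J = distr (measure_pmf (path_segment p K (Min J) (nat (Max J - Min J))))
      (PiM J (\<lambda>_. borel :: 's measure)) (\<lambda>\<omega>. restrict \<omega> J)" for J
  have P_window: "P J = distr (measure_pmf (path_segment p K m (nat (m' - m)))) (PiM J (\<lambda>_. borel))
      (\<lambda>\<omega>. restrict \<omega> J)" if "m \<in> I" "m' \<in> I" "J \<subseteq> {m..m'}" for J m m'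
  proof (cases "J = {}")
    case True
    then show ?thesis by (simp add: P_def distr_map_restrict[where J = "{}"] restrict_def)
  next
    case False
    have "finite J" using that(3) finite_subset by blast
    with False that have "m \<le> Min J" "Max J \<le> m'" "Min J \<le> Max J" "J \<subseteq> {Min J..Max J}"
      by auto
    moreover have "bind_pmf (p j) K = p (j + 1)" if "m \<le> j" "j < m'" for j
      using interval[OF \<open>m \<in> I\<close> \<open>m' \<in> I\<close>] that by (intro step) auto
    ultimately have "map_pmf (\<lambda>\<omega>. restrict \<omega> J) (path_segment p K m (nat (m' - m))) =
         map_pmf (\<lambda>\<omega>. restrict \<omega> J) (path_segment p K (Min J) (nat (Max J - Min J)))"
      by (intro path_segment_window) auto
    then show ?thesis
      unfolding P_def by (subst (1 2) distr_map_restrict) simp_all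
  qed
  have window: "\<exists>m\<in>I. \<exists>m'\<in>I. J \<subseteq> {m..m'}" if "finite J" "J \<subseteq> I" for J
  proof (cases "J = {}")
    case True
    then show ?thesis using I by (auto simp: int_interval_def)
  next
    case False
    then have "Min J \<in> I" "Max J \<in> I"
      using that Min_in[of J] Max_in[of J] by blast+
    moreover have "J \<subseteq> {Min J..Max J}" using that by auto
    ultimately show ?thesis by blast
  qed
  have restrict_measurable: "(\<lambda>\<omega>. restrict \<omega> J) \<in> measurable (measure_pmf q) (PiM J (\<lambda>_. borel :: 's measure))" for q J
    by (auto simp: space_PiM)
  interpret polish_projective I P
    unfolding polish_projective_def
  proof (rule projective_family.intro)
    fix J H :: "int set" assume JH: "J \<subseteq> H" "finite H" "H \<subseteq> I"
    then obtain m m' where m: "m \<in> I" "m' \<in> I" "H \<subseteq> {m..m'}" using window by blast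
    have "J \<subseteq> {m..m'}" using JH m by blast
    show "P J = distr (P H) (PiM J (\<lambda>_. borel)) (\<lambda>f. restrict f J)"
      unfolding P_window[OF m] P_window[OF m(1,2) \<open>J \<subseteq> {m..m'}\<close>]
      using JH(1)
      by (subst distr_distr) (auto simp: space_PiM comp_def Int_absorb1
          intro!: measurable_restrict_subset)
  next
    fix J :: "int set" assume "finite J" "J \<subseteq> I"
    show "prob_space (P J)"
      unfolding P_def by (rule prob_space.prob_space_distr[OF prob_space_measure_pmf restrict_measurable])
  qed
  have fidi: "measure lim {\<omega>\<in>space lim. \<forall>j\<in>{m..m'}. \<omega> j \<in> A j} =
      measure (path_segment p K m (nat (m' - m))) {\<omega>. \<forall>j\<in>{m..m'}. \<omega> j \<in> A j}"
    if "m \<in> I" "m' \<in> I" "\<And>j. A j \<in> sets borel" for m m' and A :: "int \<Rightarrow> 's set"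
  proof -
    let ?J = "{m..m'}"
    have J: "?J \<subseteq> I" using interval that by blast
    have "{\<omega>\<in>space lim. \<forall>j\<in>?J. \<omega> j \<in> A j} = emb I ?J (PiE ?J A)"
      using J by (auto simp: prod_emb_def space_PiM PiE_iff extensional_def)
    then have "measure lim {\<omega>\<in>space lim. \<forall>j\<in>?J. \<omega> j \<in> A j} = measure (P ?J) (PiE ?J A)"
      using J that(3) by (simp add: measure_lim_emb sets_PiM_I_finite)
    also have "\<dots> = measure (path_segment p K m (nat (m' - m))) {\<omega>. \<forall>j\<in>?J. \<omega> j \<in> A j}"
      unfolding P_window[OF that(1,2) order_refl]
      using that(3)
      by (subst measure_distr[OF restrict_measurable])
        (auto simp: sets_PiM_I_finite PiE_iff intro!: arg_cong[where f = "measure _"])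
    finally show ?thesis .
  qed
  show ?thesis
  proof (intro exI[of _ lim] conjI ballI allI impI)
    show "prob_space lim" by (rule P.prob_space_axioms)
    show "sets lim = sets (PiM I (\<lambda>_. borel))" by simp
  next
    fix i A assume "i \<in> I" "A \<in> sets (borel :: 's measure)"
    then show "measure lim {\<omega>\<in>space lim. \<omega> i \<in> A} = measure (p i) A"
      using fidi[of i i "\<lambda>_. A"] by (simp add: vimage_def)
  next
    fix m i x assume "m \<in> I" "i \<in> I" "i + 1 \<in> I" "m \<le> i"
    moreover from \<open>m \<le> i\<close> have "nat (i + 1 - m) = Suc (nat (i - m))" by linarith
    ultimately show "measure lim {\<omega>\<in>space lim. \<forall>j\<in>{m..i+1}. \<omega> j = x j} =
      measure lim {\<omega>\<in>space lim. \<forall>j\<in>{m..i}. \<omega> j = x j} * pmf (K (x i)) (x (i + 1))"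
      using fidi[of m "i + 1" "\<lambda>j. {x j}"] fidi[of m i "\<lambda>j. {x j}"]
        path_segment_markov[of p K m "nat (i - m)" x]
      by (simp del: path_segment.simps)
  qed
qed

section \<open>Chains on a countable state space\<close>

text \<open>
  \<open>M\<close> is the law of a chain that stays in the levels \<open>L i\<close>, has marginals \<open>\<pi> i\<close> and transitions \<open>T\<close>.
  The weights and transitions are plain real functions, so that the notion applies both to mass
  functions and to rules whose rows at an extreme rank have total mass other than 1.
\<close>

definition markov_path_law ::
  "int set \<Rightarrow> (int \<Rightarrow> 'a set) \<Rightarrow> (int \<Rightarrow> 'a \<Rightarrow> real) \<Rightarrow> ('a \<Rightarrow> 'a \<Rightarrow> real) \<Rightarrow> (int \<Rightarrow> 'a) measure \<Rightarrow> bool" where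
  "markov_path_law I L \<pi> T M \<longleftrightarrow>
     prob_space M \<and>
     (\<forall>i\<in>I. (\<lambda>\<omega>. \<omega> i) \<in> measurable M (count_space (L i))) \<and>
     (\<forall>i\<in>I. \<forall>A\<subseteq>L i. measure M {\<omega>\<in>space M. \<omega> i \<in> A} = infsetsum (\<pi> i) A) \<and>
     (\<forall>m\<in>I. \<forall>i\<in>I. i + 1 \<in> I \<longrightarrow> m \<le> i \<longrightarrow> (\<forall>x.
        measure M {\<omega>\<in>space M. \<forall>j\<in>{m..i+1}. \<omega> j = x j} =
        measure M {\<omega>\<in>space M. \<forall>j\<in>{m..i}. \<omega> j = x j} * T (x i) (x (i + 1))))"

lemma markov_path_lawD:
  assumes "markov_path_law I L \<pi> T M"
  shows "prob_space M"
    and "i \<in> I \<Longrightarrow> (\<lambda>\<omega>. \<omega> i) \<in> measurable M (count_space (L i))"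
    and "i \<in> I \<Longrightarrow> A \<subseteq> L i \<Longrightarrow> measure M {\<omega>\<in>space M. \<omega> i \<in> A} = infsetsum (\<pi> i) A"
    and "m \<in> I \<Longrightarrow> i \<in> I \<Longrightarrow> i + 1 \<in> I \<Longrightarrow> m \<le> i \<Longrightarrow>
      measure M {\<omega>\<in>space M. \<forall>j\<in>{m..i+1}. \<omega> j = x j} =
      measure M {\<omega>\<in>space M. \<forall>j\<in>{m..i}. \<omega> j = x j} * T (x i) (x (i + 1))"
  using assms by (simp_all add: markov_path_law_def)

text \<open>
  The states are coded as reals by an injection \<open>e\<close>, the chain is built there, and its paths are decoded.
  Decoding is forced to land in the prescribed level at every time, by sending reals that are not codes
  of elements of \<open>L i\<close> to some element of \<open>L i\<close>: the levels must be respected by all paths and not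
  just almost surely. Such reals occur with probability 0, so the laws do not change.
\<close>

lemma markov_chain_exists:
  fixes p :: "int \<Rightarrow> 'a pmf"
  assumes countable: "countable (UNIV :: 'a set)"
    and I: "int_interval I"
    and step: "\<And>i. i \<in> I \<Longrightarrow> i + 1 \<in> I \<Longrightarrow> bind_pmf (p i) K = p (i + 1)"
    and supp: "\<And>i. i \<in> I \<Longrightarrow> set_pmf (p i) \<subseteq> L i"
  shows "\<exists>M. markov_path_law I L (\<lambda>i. pmf (p i)) (\<lambda>u. pmf (K u)) M"
proof -
  define e :: "'a \<Rightarrow> real" where "e x = real (to_nat_on UNIV x)" for x
  have inj_e: "inj e"
    using inj_on_to_nat_on[OF countable] by (auto simp: e_def inj_on_def)
  define p' where "p' i = map_pmf e (p i)" for i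
  define K' where "K' r = map_pmf e (K (inv e r))" for r
  have "bind_pmf (p' i) K' = p' (i + 1)" if "i \<in> I" "i + 1 \<in> I" for i
    using step[OF that]
    by (simp add: p'_def K'_def bind_map_pmf inv_f_f[OF inj_e] flip: map_bind_pmf)
  from markov_path_measure_exists[of I p' K', OF I this]
  obtain M where M: "prob_space M" "sets M = sets (PiM I (\<lambda>_. borel))"
    and marginal: "\<And>i A. i \<in> I \<Longrightarrow> A \<in> sets borel \<Longrightarrow>
      measure M {\<omega>\<in>space M. \<omega> i \<in> A} = measure (p' i) A"
    and markov: "\<And>m i x. m \<in> I \<Longrightarrow> i \<in> I \<Longrightarrow> i + 1 \<in> I \<Longrightarrow> m \<le> i \<Longrightarrow>
      measure M {\<omega>\<in>space M. \<forall>j\<in>{m..i+1}. \<omega> j = x j} =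
      measure M {\<omega>\<in>space M. \<forall>j\<in>{m..i}. \<omega> j = x j} * pmf (K' (x i)) (x (i + 1))"
    by auto
  interpret prob_space M by (rule M(1))
  have coord[measurable]: "(\<lambda>\<omega>. \<omega> i) \<in> borel_measurable M" if "i \<in> I" for i
    using that unfolding measurable_cong_sets[OF M(2) refl] by (rule measurable_component_singleton)
  have borel_e: "e ` A \<in> sets borel" for A
    by (rule sets.countable) (auto intro!: countable_image countable_subset[OF subset_UNIV countable])
  define dec where "dec i r = (if r \<in> e ` L i then inv e r else (SOME x. x \<in> L i))" for i r
  have L_ne: "(SOME x. x \<in> L i) \<in> L i" if "i \<in> I" for i
  proof -
    have "\<exists>x. x \<in> L i" using supp[OF that] set_pmf_not_empty[of "p i"] by blast
    then show ?thesis by (rule someI_ex)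
  qed
  have dec_in: "dec i r \<in> L i" if "i \<in> I" for i r
    using L_ne[OF that] by (auto simp: dec_def inv_f_f[OF inj_e])
  have dec_eq: "dec i r \<in> A \<longleftrightarrow> r \<in> e ` A" if "r \<in> e ` L i" "A \<subseteq> L i" for i r A
    using that by (auto simp: dec_def inv_f_f[OF inj_e] dest: injD[OF inj_e])
  have dec_measurable: "dec i \<in> measurable borel (count_space (L i))" if i: "i \<in> I" for i
  proof (subst measurable_count_space_eq_countable)
    show "countable (L i)" by (rule countable_subset[OF subset_UNIV countable])
    have "dec i -` {a} \<in> sets borel" if a: "a \<in> L i" for a
    proof (cases "a = (SOME x. x \<in> L i)")
      case True
      with a have "dec i -` {a} = UNIV - e ` (L i - {a})"
        by (auto simp: dec_def inv_f_f[OF inj_e] inj_image_mem_iff[OF inj_e] split: if_splits)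
      then show ?thesis using borel_e[of "L i - {a}"] by auto
    next
      case False
      with a have "dec i -` {a} = e ` {a}"
        by (auto simp: dec_def inv_f_f[OF inj_e] split: if_splits)
      then show ?thesis using borel_e[of "{a}"] by simp
    qed
    then show "dec i \<in> space borel \<rightarrow> L i \<and> (\<forall>a\<in>L i. dec i -` {a} \<inter> space borel \<in> sets borel)"
      using dec_in[OF i] by auto
  qed
  have AE_level: "AE \<omega> in M. \<omega> i \<in> e ` L i" if i: "i \<in> I" for i
  proof -
    have "measure M {\<omega>\<in>space M. \<omega> i \<in> e ` L i} = measure (p i) (L i)"
      unfolding marginal[OF i borel_e]
      by (simp add: p'_def inj_vimage_image_eq[OF inj_e])
    also have "\<dots> = 1"
      using supp[OF i] by (auto simp: measure_pmf.prob_eq_1 AE_measure_pmf_iff)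
    finally show ?thesis
      using i borel_e[of "L i"] by (subst (asm) prob_Collect_eq_1) auto
  qed
  define N where "N = PiM I (\<lambda>i. count_space (L i))"
  define \<Phi> where "\<Phi> \<omega> = (\<lambda>i\<in>I. dec i (\<omega> i))" for \<omega> :: "int \<Rightarrow> real"
  have \<Phi>[measurable]: "\<Phi> \<in> measurable M N"
    unfolding N_def \<Phi>_def
    by (intro measurable_restrict measurable_compose[OF coord dec_measurable])
  have coord_N: "(\<lambda>\<omega>. \<omega> i) \<in> measurable N (count_space (L i))" if "i \<in> I" for i
    using that unfolding N_def by measurable
  have path_event: "measure (distr M N \<Phi>) {\<omega>\<in>space N. \<forall>j\<in>J. \<omega> j = x j} =
      measure M {\<omega>\<in>space M. \<forall>j\<in>J. \<omega> j = e (x j)}" if J: "finite J" "J \<subseteq> I" for J x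
  proof -
    have meas: "{\<omega>\<in>space N. \<forall>j\<in>J. \<omega> j = x j} \<in> sets N"
    proof (rule sets.sets_Collect_finite_All)
      fix j assume "j \<in> J"
      with J have "(\<lambda>\<omega>. \<omega> j) \<in> measurable N (count_space (L j))" by (intro coord_N) auto
      from measurable_compose[OF this, of "\<lambda>a. a = x j" "count_space UNIV"]
      show "{\<omega>\<in>space N. \<omega> j = x j} \<in> sets N" by (auto simp: pred_def)
    qed (use J in auto)
    have "measure (distr M N \<Phi>) {\<omega>\<in>space N. \<forall>j\<in>J. \<omega> j = x j} =
        measure M (\<Phi> -` {\<omega>\<in>space N. \<forall>j\<in>J. \<omega> j = x j} \<inter> space M)"
      by (rule measure_distr[OF \<Phi> meas])
    also have "\<dots> = measure M {\<omega>\<in>space M. \<forall>j\<in>J. \<omega> j = e (x j)}"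
    proof (rule measure_eq_AE)
      have "AE \<omega> in M. \<forall>j\<in>J. \<omega> j \<in> e ` L j"
        using J by (intro AE_finite_allI AE_level) auto
      then show "AE \<omega> in M. \<omega> \<in> \<Phi> -` {\<omega>\<in>space N. \<forall>j\<in>J. \<omega> j = x j} \<inter> space M \<longleftrightarrow>
          \<omega> \<in> {\<omega>\<in>space M. \<forall>j\<in>J. \<omega> j = e (x j)}"
      proof (rule AE_mp, intro AE_I2 impI)
        fix \<omega> assume \<omega>: "\<omega> \<in> space M" "\<forall>j\<in>J. \<omega> j \<in> e ` L j"
        have "\<Phi> \<omega> j = x j \<longleftrightarrow> \<omega> j = e (x j)" if "j \<in> J" for j
        proof -
          have "dec j (\<omega> j) = inv e (\<omega> j)" "\<omega> j \<in> range e"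
            using \<omega>(2) that by (auto simp: dec_def)
          then show ?thesis
            using that J(2) by (auto simp: \<Phi>_def inv_f_f[OF inj_e] dest: injD[OF inj_e])
        qed
        then show "\<omega> \<in> \<Phi> -` {\<omega>\<in>space N. \<forall>j\<in>J. \<omega> j = x j} \<inter> space M \<longleftrightarrow>
            \<omega> \<in> {\<omega>\<in>space M. \<forall>j\<in>J. \<omega> j = e (x j)}"
          using \<omega>(1) measurable_space[OF \<Phi> \<omega>(1)] by auto
      qed
      show "\<Phi> -` {\<omega>\<in>space N. \<forall>j\<in>J. \<omega> j = x j} \<inter> space M \<in> sets M"
        by (rule measurable_sets[OF \<Phi> meas])
      show "{\<omega>\<in>space M. \<forall>j\<in>J. \<omega> j = e (x j)} \<in> sets M"
        using J coord by (intro sets.sets_Collect_finite_All) (auto intro!: borel_measurable_eq)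
    qed
    finally show ?thesis .
  qed
  have interval: "{a..b} \<subseteq> I" if "a \<in> I" "b \<in> I" for a b
    using I that by (auto simp: int_interval_def)
  have "markov_path_law I L (\<lambda>i. pmf (p i)) (\<lambda>u. pmf (K u)) (distr M N \<Phi>)"
    unfolding markov_path_law_def
  proof (intro conjI ballI allI impI)
    show "prob_space (distr M N \<Phi>)" by (rule prob_space_distr[OF \<Phi>])
  next
    fix i assume i: "i \<in> I"
    show "(\<lambda>\<omega>. \<omega> i) \<in> measurable (distr M N \<Phi>) (count_space (L i))"
      using coord_N[OF i] by simp
  next
    fix i A assume i: "i \<in> I" and A: "A \<subseteq> L i"
    have "{\<omega>\<in>space N. \<omega> i \<in> A} \<in> sets N"
      using measurable_sets[OF coord_N[OF i], of A] A by (simp add: vimage_def Int_def conj_commute)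
    then have "measure (distr M N \<Phi>) {\<omega>\<in>space N. \<omega> i \<in> A} =
        measure M (\<Phi> -` {\<omega>\<in>space N. \<omega> i \<in> A} \<inter> space M)"
      by (rule measure_distr[OF \<Phi>])
    also have "\<dots> = measure M {\<omega>\<in>space M. dec i (\<omega> i) \<in> A}"
      using measurable_space[OF \<Phi>] i by (intro arg_cong[where f = "measure M"]) (auto simp: \<Phi>_def)
    also have "\<dots> = measure M {\<omega>\<in>space M. \<omega> i \<in> e ` A}"
    proof (rule measure_eq_AE)
      show "AE \<omega> in M. \<omega> \<in> {\<omega>\<in>space M. dec i (\<omega> i) \<in> A} \<longleftrightarrow> \<omega> \<in> {\<omega>\<in>space M. \<omega> i \<in> e ` A}"
        using AE_level[OF i] by eventually_elim (use dec_eq[OF _ A] in auto)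
      show "{\<omega>\<in>space M. dec i (\<omega> i) \<in> A} \<in> sets M"
        using measurable_sets[OF measurable_compose[OF coord[OF i] dec_measurable[OF i]], of A] A
        by (simp add: vimage_def Int_def conj_commute)
      show "{\<omega>\<in>space M. \<omega> i \<in> e ` A} \<in> sets M"
        using measurable_sets[OF coord[OF i] borel_e[of A]]
        by (simp add: vimage_def Int_def conj_commute)
    qed
    also have "\<dots> = measure (p i) A"
      unfolding marginal[OF i borel_e] by (simp add: p'_def inj_vimage_image_eq[OF inj_e])
    finally show "measure (distr M N \<Phi>) {\<omega>\<in>space (distr M N \<Phi>). \<omega> i \<in> A} = infsetsum (pmf (p i)) A"
      by (simp add: measure_pmf_conv_infsetsum)
  next
    fix m i x assume mi: "m \<in> I" "i \<in> I" "i + 1 \<in> I" "m \<le> i"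
    have "pmf (K' (e (x i))) (e (x (i + 1))) = pmf (K (x i)) (x (i + 1))"
      by (simp add: K'_def inv_f_f[OF inj_e] pmf_map_inj'[OF inj_e])
    then show "measure (distr M N \<Phi>) {\<omega>\<in>space (distr M N \<Phi>). \<forall>j\<in>{m..i+1}. \<omega> j = x j} =
      measure (distr M N \<Phi>) {\<omega>\<in>space (distr M N \<Phi>). \<forall>j\<in>{m..i}. \<omega> j = x j} *
        pmf (K (x i)) (x (i + 1))"
      using markov[OF mi, of "\<lambda>j. e (x j)"]
        path_event[of "{m..i+1}" x, OF _ interval[OF mi(1,3)]]
        path_event[of "{m..i}" x, OF _ interval[OF mi(1,2)]]
      by simp
  qed
  then show ?thesis ..
qed

section \<open>Chains driven by rules\<close>

lemma nn_integral_count_space_has_sum: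
  fixes f :: "'a \<Rightarrow> real"
  assumes "(f has_sum s) UNIV" "\<And>x. 0 \<le> f x"
  shows "(\<integral>\<^sup>+x. ennreal (f x) \<partial>count_space UNIV) = ennreal s"
proof -
  have "(\<lambda>x. norm (f x)) summable_on UNIV"
    using assms by (simp add: has_sum_imp_summable)
  then have abs: "Infinite_Set_Sum.abs_summable_on f UNIV" using abs_summable_equivalent by blast
  show ?thesis
    using nn_integral_conv_infsetsum[OF abs] infsetsum_infsum[OF abs] infsumI[OF assms(1)] assms(2)
    by simp
qed

text \<open>
  The second branch only makes the kernel total: for a rule, a row of mass other than 1 belongs to an
  element of extreme rank, at which the chain ends.
\<close>

definition rule_pmf :: "('a \<Rightarrow> 'a \<Rightarrow> real) \<Rightarrow> 'a \<Rightarrow> 'a pmf" where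
  "rule_pmf T u = (if (T u has_sum 1) UNIV then embed_pmf (T u) else return_pmf u)"

lemma pmf_rule_pmf:
  assumes "\<And>v. 0 \<le> T u v" "(T u has_sum 1) UNIV"
  shows "pmf (rule_pmf T u) v = T u v"
  using assms nn_integral_count_space_has_sum[OF assms(2,1)]
  by (simp add: rule_pmf_def pmf_embed_pmf)

text \<open>
  The operator that a rule induces on summable functions agrees with one step of its kernel
  on distributions. The bound by 1 makes the defining sum of the operator converge.
\<close>

lemma bind_rule_pmf:
  assumes T: "\<And>u v. 0 \<le> T u v \<and> T u v \<le> 1"
    and total: "\<And>u. u \<in> set_pmf q \<Longrightarrow> (T u has_sum 1) UNIV"
    and q': "rule_op T (pmf q) = pmf q'"
  shows "bind_pmf q (rule_pmf T) = q'"
proof (rule pmf_eqI)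
  fix v
  have pmf_sum: "pmf q summable_on UNIV"
    using pmf_abs_summable[of q UNIV] abs_summable_equivalent summable_on_iff_abs_summable_on_real
    by blast
  have "(\<lambda>u. T u v * pmf q u) summable_on UNIV"
    by (rule summable_on_comparison_test[OF pmf_sum]) (use T in \<open>auto intro: mult_left_le_one_le\<close>)
  moreover have "(\<Sum>\<^sub>\<infinity>u. T u v * pmf q u) = pmf q' v"
    using fun_cong[OF q', of v] by (simp add: rule_op_def)
  ultimately have sum: "((\<lambda>u. T u v * pmf q u) has_sum pmf q' v) UNIV"
    by (metis has_sum_infsum)
  have "ennreal (pmf (bind_pmf q (rule_pmf T)) v) = (\<integral>\<^sup>+u. pmf (rule_pmf T u) v \<partial>measure_pmf q)"
    by (rule ennreal_pmf_bind)
  also have "\<dots> = (\<integral>\<^sup>+u. T u v \<partial>measure_pmf q)"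
    by (intro nn_integral_cong_AE) (use T total in \<open>auto simp: AE_measure_pmf_iff pmf_rule_pmf\<close>)
  also have "\<dots> = (\<integral>\<^sup>+u. ennreal (T u v * pmf q u) \<partial>count_space UNIV)"
    using T by (simp add: measure_pmf_eq_density nn_integral_density ennreal_mult mult.commute)
  also have "\<dots> = ennreal (pmf q' v)"
    using T by (intro nn_integral_count_space_has_sum[OF sum]) simp
  finally show "pmf (bind_pmf q (rule_pmf T)) v = pmf q' v" by simp
qed

lemma has_sum_prob_dists:
  assumes "\<pi> \<in> prob_dists S" "S \<subseteq> S'"
  shows "(\<pi> has_sum 1) S'"
proof -
  have "(\<pi> has_sum 1) S' \<longleftrightarrow> (\<pi> has_sum 1) S"
    using assms by (intro has_sum_cong_neutral) (auto simp: prob_dists_def)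
  then show ?thesis using assms by (simp add: prob_dists_def)
qed

text \<open>
  The form of the existence result that is symmetric in up and down rules: it mentions only levels
  indexed by an interval and a rule whose rows have mass 1 below the top index.
\<close>

lemma rule_chain_exists:
  fixes \<pi> :: "int \<Rightarrow> 'a \<Rightarrow> real"
  assumes countable: "countable (UNIV :: 'a set)"
    and I: "int_interval I"
    and T: "\<And>u v. 0 \<le> T u v \<and> T u v \<le> 1"
    and total: "\<And>i u. i \<in> I \<Longrightarrow> i + 1 \<in> I \<Longrightarrow> u \<in> L i \<Longrightarrow> (T u has_sum 1) UNIV"
    and \<pi>: "\<And>i. i \<in> I \<Longrightarrow> \<pi> i \<in> prob_dists (L i)"
    and step: "\<And>i. i \<in> I \<Longrightarrow> i + 1 \<in> I \<Longrightarrow> rule_op T (\<pi> i) = \<pi> (i + 1)"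
  shows "\<exists>M. markov_path_law I L \<pi> T M"
proof -
  define p where "p i = embed_pmf (\<pi> i)" for i
  have pmf_p: "pmf (p i) = \<pi> i" if "i \<in> I" for i
  proof -
    have nonneg: "\<And>u. 0 \<le> \<pi> i u" using \<pi>[OF that] by (simp add: prob_dists_def)
    show ?thesis
      unfolding p_def
      using nn_integral_count_space_has_sum[OF has_sum_prob_dists[OF \<pi>[OF that] subset_UNIV] nonneg]
      by (intro ext pmf_embed_pmf) (auto simp: nonneg)
  qed
  have supp: "set_pmf (p i) \<subseteq> L i" if "i \<in> I" for i
    using \<pi>[OF that] pmf_p[OF that] by (auto simp: set_pmf_eq prob_dists_def)
  have p_step: "bind_pmf (p i) (rule_pmf T) = p (i + 1)" if "i \<in> I" "i + 1 \<in> I" for i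
    using T step[OF that] supp[OF that(1)] total[OF that] that
    by (intro bind_rule_pmf) (auto simp: pmf_p)
  obtain M where M: "markov_path_law I L (\<lambda>i. pmf (p i)) (\<lambda>u. pmf (rule_pmf T u)) M"
    using markov_chain_exists[of I p "rule_pmf T" L, OF countable I p_step supp] by blast
  have "markov_path_law I L \<pi> T M"
    unfolding markov_path_law_def
  proof (intro conjI ballI allI impI)
    show "prob_space M" by (rule markov_path_lawD(1)[OF M])
  next
    fix i assume "i \<in> I"
    then show "(\<lambda>\<omega>. \<omega> i) \<in> measurable M (count_space (L i))"
      by (rule markov_path_lawD(2)[OF M])
  next
    fix i A assume "i \<in> I" "A \<subseteq> L i"
    then show "measure M {\<omega>\<in>space M. \<omega> i \<in> A} = infsetsum (\<pi> i) A"
      by (simp add: markov_path_lawD(3)[OF M] pmf_p)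
  next
    fix m i x assume mi: "m \<in> I" "i \<in> I" "i + 1 \<in> I" "m \<le> i"
    show "measure M {\<omega>\<in>space M. \<forall>j\<in>{m..i+1}. \<omega> j = x j} =
      measure M {\<omega>\<in>space M. \<forall>j\<in>{m..i}. \<omega> j = x j} * T (x i) (x (i + 1))"
    proof (cases "x i \<in> L i")
      case True
      then show ?thesis
        using markov_path_lawD(4)[OF M mi, of x] T total[OF mi(2,3)] by (simp add: pmf_rule_pmf)
    next
      case False
      \<comment> \<open>A prescribed path that leaves its level is impossible, so both sides vanish.\<close>
      have X: "(\<lambda>\<omega>. \<omega> i) \<in> measurable M (count_space (L i))"
        by (rule markov_path_lawD(2)[OF M mi(2)])
      have "\<omega> i \<noteq> x i" if "\<omega> \<in> space M" for \<omega>
        using measurable_space[OF X that] False by auto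
      then have no_path: "{\<omega>\<in>space M. \<forall>j\<in>{m..k}. \<omega> j = x j} = {}" if "i \<le> k" for k
        using mi(4) that by fastforce
      show ?thesis by (simp add: no_path)
    qed
  qed
  then show ?thesis ..
qed

lemma nonmaximal_iff:
  assumes "int_interval I"
  shows "nonmaximal I i \<longleftrightarrow> i \<in> I \<and> i + 1 \<in> I"
proof
  assume "nonmaximal I i"
  then obtain j where "i \<in> I" "j \<in> I" "i < j" by (auto simp: nonmaximal_def)
  moreover from this have "{i..j} \<subseteq> I" "i + 1 \<in> {i..j}" using assms by (auto simp: int_interval_def)
  ultimately show "i \<in> I \<and> i + 1 \<in> I" by blast
qed (auto simp: nonmaximal_def intro!: bexI[of _ "i + 1"])

lemma nonminimal_iff:
  assumes "int_interval I"
  shows "nonminimal I i \<longleftrightarrow> i \<in> I \<and> i - 1 \<in> I"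
proof
  assume "nonminimal I i"
  then obtain j where "i \<in> I" "j \<in> I" "j < i" by (auto simp: nonminimal_def)
  moreover from this have "{j..i} \<subseteq> I" "i - 1 \<in> {j..i}" using assms by (auto simp: int_interval_def)
  ultimately show "i \<in> I \<and> i - 1 \<in> I" by blast
qed (auto simp: nonminimal_def intro!: bexI[of _ "i - 1"])

lemma int_interval_uminus:
  assumes "int_interval I"
  shows "int_interval (uminus ` I)"
proof -
  have "{- a..- b} \<subseteq> uminus ` I" if "a \<in> I" "b \<in> I" for a b
  proof -
    have "uminus ` {b..a} \<subseteq> uminus ` I"
      using that assms by (intro image_mono) (auto simp: int_interval_def)
    then show ?thesis by simp
  qed
  then show ?thesis using assms by (simp add: int_interval_def)
qed

text \<open>
  The two chains share the marginals \<open>\<pi> i\<close>. The down chain is built as a chain running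
  forward over \<open>- I\<close>, with level \<open>- i\<close> at time \<open>i\<close>, and is read backwards as \<open>Y i \<omega> = \<omega> (- i)\<close>.
\<close>

lemma UD_sequence_compatible:
  fixes \<rho> :: "'a::order \<Rightarrow> int"
  assumes graded: "graded_poset I \<rho>" and U: "up_rule I \<rho> U" and D: "down_rule I \<rho> D"
    and \<pi>: "\<And>i. i \<in> I \<Longrightarrow> \<pi> i \<in> prob_dists (level \<rho> i)"
    and Useq: "U_sequence I U \<pi>" and Dseq: "D_sequence I D \<pi>"
  shows "compatible I \<rho> U D"
proof -
  have countable: "countable (UNIV :: 'a set)" and I: "int_interval I"
    using graded by (auto simp: graded_poset_def)
  note up = nonmaximal_iff[OF I] and down = nonminimal_iff[OF I]
  have "\<exists>M. markov_path_law I (level \<rho>) \<pi> U M"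
  proof (rule rule_chain_exists[OF countable I])
    show "0 \<le> U u v \<and> U u v \<le> 1" for u v using U by (simp add: up_rule_def)
    show "(U u has_sum 1) UNIV" if "i \<in> I" "i + 1 \<in> I" "u \<in> level \<rho> i" for i u
      using U that by (auto simp: up_rule_def up level_def)
    show "rule_op U (\<pi> i) = \<pi> (i + 1)" if "i \<in> I" "i + 1 \<in> I" for i
      using Useq that by (auto simp: U_sequence_def up)
  qed (rule \<pi>)
  then obtain M where M: "markov_path_law I (level \<rho>) \<pi> U M" ..
  have uminus_mem: "i \<in> uminus ` I \<longleftrightarrow> - i \<in> I" for i
    by (metis image_iff minus_minus)
  have "\<exists>N. markov_path_law (uminus ` I) (\<lambda>i. level \<rho> (- i)) (\<lambda>i. \<pi> (- i)) D N"
  proof (rule rule_chain_exists[OF countable int_interval_uminus[OF I]])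
    show "0 \<le> D u v \<and> D u v \<le> 1" for u v using D by (simp add: down_rule_def)
    show "(D u has_sum 1) UNIV" if "i \<in> uminus ` I" "i + 1 \<in> uminus ` I" "u \<in> level \<rho> (- i)" for i u
    proof -
      have "nonminimal I (\<rho> u)" using that by (simp add: down level_def uminus_mem)
      then show ?thesis using D by (simp add: down_rule_def)
    qed
    show "rule_op D (\<pi> (- i)) = \<pi> (- (i + 1))" if "i \<in> uminus ` I" "i + 1 \<in> uminus ` I" for i
    proof -
      have "nonminimal I (- i)" using that by (simp add: down uminus_mem)
      then have "rule_op D (\<pi> (- i)) = \<pi> (- i - 1)" using Dseq by (simp add: D_sequence_def)
      then show ?thesis by simp
    qed
    show "\<pi> (- i) \<in> prob_dists (level \<rho> (- i))" if "i \<in> uminus ` I" for i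
      using \<pi> that by (simp add: uminus_mem)
  qed
  then obtain N where
    N: "markov_path_law (uminus ` I) (\<lambda>i. level \<rho> (- i)) (\<lambda>i. \<pi> (- i)) D N" ..
  have Y: "(\<lambda>\<omega>. \<omega> (- i)) \<in> measurable N (count_space (level \<rho> i))" if "i \<in> I" for i
  proof -
    have "- i \<in> uminus ` I" using that by simp
    from markov_path_lawD(2)[OF N this] show ?thesis by simp
  qed
  have "up_chain I \<rho> U M (\<lambda>i \<omega>. \<omega> i)"
    unfolding up_chain_def using M by (auto simp: markov_path_law_def up)
  moreover have "down_chain I \<rho> D N (\<lambda>i \<omega>. \<omega> (- i))"
    unfolding down_chain_def
  proof (intro conjI ballI allI impI)
    show "prob_space N" by (rule markov_path_lawD(1)[OF N])
    show "(\<lambda>\<omega>. \<omega> (- i)) \<in> measurable N (count_space (level \<rho> i))" if "i \<in> I" for i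
      using Y that .
    fix m i y assume mi: "m \<in> I" "nonminimal I i" "i \<le> m"
    have reflect: "(\<forall>j\<in>{a..m}. \<omega> (- j) = y j) \<longleftrightarrow> (\<forall>j\<in>{- m..- a}. \<omega> j = y (- j))"
      for a :: int and \<omega> :: "int \<Rightarrow> 'a"
      by (simp flip: image_uminus_atLeastAtMost)
    show "measure N {\<omega>\<in>space N. \<forall>j\<in>{i-1..m}. \<omega> (- j) = y j} =
      measure N {\<omega>\<in>space N. \<forall>j\<in>{i..m}. \<omega> (- j) = y j} * D (y i) (y (i - 1))"
    proof -
      have "- m \<in> uminus ` I" "- i \<in> uminus ` I" "- i + 1 \<in> uminus ` I" "- m \<le> - i"
        using mi by (auto simp: down uminus_mem)
      then have "measure N {\<omega>\<in>space N. \<forall>j\<in>{- m..- i + 1}. \<omega> j = y (- j)} =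
          measure N {\<omega>\<in>space N. \<forall>j\<in>{- m..- i}. \<omega> j = y (- j)} * D (y (- (- i))) (y (- (- i + 1)))"
        by (rule markov_path_lawD(4)[OF N])
      moreover have "- (i - 1) = - i + 1" "- (- i + 1) = i - 1" by simp_all
      ultimately show ?thesis by (simp only: reflect minus_minus)
    qed
  qed
  moreover have "distr M (count_space (level \<rho> i)) (\<lambda>\<omega>. \<omega> i) =
      distr N (count_space (level \<rho> i)) (\<lambda>\<omega>. \<omega> (- i))" if i: "i \<in> I" for i
  proof (rule measure_eqI)
    interpret M: prob_space M by (rule markov_path_lawD(1)[OF M])
    interpret N: prob_space N by (rule markov_path_lawD(1)[OF N])
    fix A assume "A \<in> sets (distr M (count_space (level \<rho> i)) (\<lambda>\<omega>. \<omega> i))"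
    then have A: "A \<subseteq> level \<rho> i" by simp
    have X: "(\<lambda>\<omega>. \<omega> i) \<in> measurable M (count_space (level \<rho> i))"
      by (rule markov_path_lawD(2)[OF M i])
    have "measure M {\<omega>\<in>space M. \<omega> i \<in> A} = measure N {\<omega>\<in>space N. \<omega> (- i) \<in> A}"
    proof -
      have "measure M {\<omega>\<in>space M. \<omega> i \<in> A} = infsetsum (\<pi> i) A"
        by (rule markov_path_lawD(3)[OF M i A])
      also have "\<dots> = measure N {\<omega>\<in>space N. \<omega> (- i) \<in> A}"
      proof -
        have "- i \<in> uminus ` I" "A \<subseteq> level \<rho> (- (- i))" using i A by auto
        from markov_path_lawD(3)[OF N this] show ?thesis by simp
      qed
      finally show ?thesis .
    qed
    then show "emeasure (distr M (count_space (level \<rho> i)) (\<lambda>\<omega>. \<omega> i)) A =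
        emeasure (distr N (count_space (level \<rho> i)) (\<lambda>\<omega>. \<omega> (- i))) A"
      using A X Y[OF i]
      by (simp add: emeasure_distr M.emeasure_eq_measure N.emeasure_eq_measure vimage_def Int_def conj_commute)
  qed simp
  ultimately show ?thesis unfolding compatible_def by blast
qed

section \<open>Stationarity of the UD-process\<close>

text \<open>
  The two halves of the invariance equation decouple, because \<open>p\<close> and \<open>q\<close> live on different levels and
  every step changes the level. Off the target level both \<open>rule_op U p\<close> and \<open>q\<close> vanish (likewise for
  \<open>D\<close>), which upgrades the equation on one level to an equality of functions.
\<close>

lemma stationary_UD_iff:
  assumes U: "\<And>u v. U u v \<noteq> 0 \<Longrightarrow> \<rho> v = \<rho> u + 1"
    and D: "\<And>u v. D u v \<noteq> 0 \<Longrightarrow> \<rho> u = \<rho> v + 1"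
    and p: "p \<in> prob_dists (level \<rho> i)" and q: "q \<in> prob_dists (level \<rho> (i + 1))"
  shows "stationary (UD_states \<rho> i) (UD_kernel \<rho> U D i) (\<lambda>u. (p u + q u) / 2) \<longleftrightarrow>
    rule_op U p = q \<and> rule_op D q = p"
proof -
  let ?S = "UD_states \<rho> i" and ?\<mu> = "\<lambda>u. (p u + q u) / 2"
  let ?flow = "\<lambda>v. \<Sum>\<^sub>\<infinity>u\<in>?S. ?\<mu> u * UD_kernel \<rho> U D i u v"
  have p0: "p u = 0" if "\<rho> u \<noteq> i" for u using p that by (auto simp: prob_dists_def level_def)
  have q0: "q u = 0" if "\<rho> u \<noteq> i + 1" for u using q that by (auto simp: prob_dists_def level_def)
  have dist: "?\<mu> \<in> prob_dists ?S"
  proof -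
    have "(?\<mu> has_sum 1) X" if "?S \<subseteq> X" for X
      using has_sum_cmult_left[OF has_sum_add[OF has_sum_prob_dists[OF p, of X]
            has_sum_prob_dists[OF q, of X]], of "1 / 2"] that
      by (auto simp: UD_states_def)
    from this[of ?S] this[of UNIV] have "(?\<mu> has_sum 1) ?S" "?\<mu> summable_on UNIV"
      by (auto simp: has_sum_imp_summable)
    moreover have "0 \<le> ?\<mu> u" for u using p q by (simp add: prob_dists_def)
    moreover have "?\<mu> u = 0" if "u \<notin> ?S" for u
      using that p0[of u] q0[of u] by (auto simp: UD_states_def level_def)
    ultimately show ?thesis by (auto simp: prob_dists_def l1_def)
  qed
  have flow_up: "?flow v = rule_op U p v / 2" if "v \<in> level \<rho> (i + 1)" for v
  proof -
    have "?flow v = (\<Sum>\<^sub>\<infinity>u. (U u v * p u) * (1 / 2))"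
      using that U by (intro infsum_cong_neutral)
        (auto simp: UD_states_def level_def UD_kernel_def p0 q0)
    then show ?thesis by (simp only: infsum_cmult_left' rule_op_def)
  qed
  have flow_down: "?flow v = rule_op D q v / 2" if "v \<in> level \<rho> i" for v
  proof -
    have "?flow v = (\<Sum>\<^sub>\<infinity>u. (D u v * q u) * (1 / 2))"
      using that D by (intro infsum_cong_neutral)
        (auto simp: UD_states_def level_def UD_kernel_def p0 q0)
    then show ?thesis by (simp only: infsum_cmult_left' rule_op_def)
  qed
  have U_off: "rule_op U p v = q v" if "v \<notin> level \<rho> (i + 1)" for v
  proof -
    have "(\<Sum>\<^sub>\<infinity>u. U u v * p u) = 0"
      using U[of _ v] p0 that by (intro infsum_0) (force simp: level_def)
    then show ?thesis using q0 that by (simp add: rule_op_def level_def)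
  qed
  have D_off: "rule_op D q v = p v" if "v \<notin> level \<rho> i" for v
  proof -
    have "(\<Sum>\<^sub>\<infinity>u. D u v * q u) = 0"
      using D[of _ v] q0 that by (intro infsum_0) (force simp: level_def)
    then show ?thesis using p0 that by (simp add: rule_op_def level_def)
  qed
  have "(\<forall>v\<in>level \<rho> (i + 1). ?flow v = ?\<mu> v) \<longleftrightarrow> rule_op U p = q"
  proof -
    have "?flow v = ?\<mu> v \<longleftrightarrow> rule_op U p v = q v" if "v \<in> level \<rho> (i + 1)" for v
      using flow_up[OF that] p0[of v] that by (simp add: level_def)
    then show ?thesis using U_off by (auto simp: fun_eq_iff)
  qed
  moreover have "(\<forall>v\<in>level \<rho> i. ?flow v = ?\<mu> v) \<longleftrightarrow> rule_op D q = p"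
  proof -
    have "?flow v = ?\<mu> v \<longleftrightarrow> rule_op D q v = p v" if "v \<in> level \<rho> i" for v
      using flow_down[OF that] q0[of v] that by (simp add: level_def)
    then show ?thesis using D_off by (auto simp: fun_eq_iff)
  qed
  ultimately show ?thesis
    using dist unfolding stationary_def by (auto simp: UD_states_def)
qed

theorem theorem2:
  fixes I :: "int set"
    and \<rho> :: "'a::order \<Rightarrow> int"
    and U D :: "'a \<Rightarrow> 'a \<Rightarrow> real"
    and \<pi> :: "int \<Rightarrow> 'a \<Rightarrow> real"
  assumes "graded_poset I \<rho>"
    and "up_rule I \<rho> U"
    and "down_rule I \<rho> D"
    and "\<forall>i\<in>I. \<pi> i \<in> prob_dists (level \<rho> i)"
  shows "(U_sequence I U \<pi> \<and> D_sequence I D \<pi> \<longleftrightarrow>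
           (\<forall>i. i \<in> I \<and> i + 1 \<in> I \<longrightarrow>
              stationary (UD_states \<rho> i) (UD_kernel \<rho> U D i)
                (\<lambda>u. (\<pi> i u + \<pi> (i + 1) u) / 2))) \<and>
         (U_sequence I U \<pi> \<and> D_sequence I D \<pi> \<longrightarrow> compatible I \<rho> U D)"
proof (intro conjI impI)
  have I: "int_interval I" and cover: "\<And>u v. u \<lessdot> v \<Longrightarrow> \<rho> v = \<rho> u + 1"
    using assms(1) by (auto simp: graded_poset_def)
  have U: "\<rho> v = \<rho> u + 1" if "U u v \<noteq> 0" for u v
    using assms(2) that cover by (metis up_rule_def order_le_less)
  have D: "\<rho> u = \<rho> v + 1" if "D u v \<noteq> 0" for u v
    using assms(3) that cover by (metis down_rule_def order_le_less)
  have "D_sequence I D \<pi> \<longleftrightarrow> (\<forall>i. i \<in> I \<and> i + 1 \<in> I \<longrightarrow> rule_op D (\<pi> (i + 1)) = \<pi> i)"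
    unfolding D_sequence_def nonminimal_iff[OF I]
    by (metis add_diff_cancel_right' diff_add_cancel)
  moreover have "U_sequence I U \<pi> \<longleftrightarrow> (\<forall>i. i \<in> I \<and> i + 1 \<in> I \<longrightarrow> rule_op U (\<pi> i) = \<pi> (i + 1))"
    by (simp add: U_sequence_def nonmaximal_iff[OF I])
  ultimately show "U_sequence I U \<pi> \<and> D_sequence I D \<pi> \<longleftrightarrow>
      (\<forall>i. i \<in> I \<and> i + 1 \<in> I \<longrightarrow> stationary (UD_states \<rho> i) (UD_kernel \<rho> U D i)
        (\<lambda>u. (\<pi> i u + \<pi> (i + 1) u) / 2))"
    using stationary_UD_iff[of U \<rho> D, OF U D] assms(4) by auto
next
  assume "U_sequence I U \<pi> \<and> D_sequence I D \<pi>"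
  then show "compatible I \<rho> U D"
    using assms by (intro UD_sequence_compatible) auto
qed

end
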